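(* Let $\rho_n,\rho_m>0$, $R_0>0$, $0<\eta\le 1$, let $h_n,h_m\in\mathbb{C}$ with $h_n\ne0$, and set $\epsilon_0=2^{R_0}-1$ and $\tau_m=\max\{0,\ \rho_m|h_m|^2/\epsilon_0-1\}$. Let $R_n^*$ be the maximum achievable data rate of user $U_n$ under hybrid NOMA with energy parameter $\eta$, i.e. $$R_n^*=\max\left\{\log\left(1+\beta_1\rho_n|h_n|^2\right)+\log\left(1+\beta_2\rho_n|h_n|^2\right):\ \beta_1,\beta_2\in[0,1],\ \beta_1+\beta_2\le\eta,\ \beta_1\rho_n|h_n|^2\le\tau_m\right\},$$ and let $R_n^{\mathrm{OMA}}=\log\left(1+\rho_n|h_n|^2\right)$. Then $R_n^*>R_n^{\mathrm{OMA}}$ if and only if either $$\frac{\tau_m}{\rho_n|h_n|^2}\ge\frac{\eta}{2}\quad\text{and}\quad |h_n|^2>\frac{4(1-\eta)}{\eta^2\rho_n},$$ or $$0<\frac{\tau_m}{\rho_n|h_n|^2}<\frac{\eta}{2},\quad \tau_m>\frac{1}{\eta}-1,\quad\text{and}\quad |h_n|^2>\frac{\tau_m^2}{\rho_n\left(\eta+\tau_m\eta-1\right)}.$$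
   Context: Here $\log$ is the logarithm to base 2. The setting is a two-user uplink with users $U_m$ and $U_n$, transmit powers $\rho_m,\rho_n$, channel coefficients $h_m,h_n$, and unit noise power. User $U_m$ has target data rate $R_0$. In hybrid NOMA (non-orthogonal multiple access), user $U_n$ transmits with power $\beta_1\rho_n$ in $U_m$'s time slot and with power $\beta_2\rho_n$ in its own time slot; in OMA (orthogonal multiple access) it transmits with full power $\rho_n$ in its own slot only. The quantity $\tau_m$ is the maximal interference power under which $U_m$'s signal can still be decoded at rate $R_0$. *)

theory Defs
  imports "HOL-Analysis.Analysis"
begin

definition snr_threshold :: "real \<Rightarrow> real" where
  "snr_threshold R0 = 2 powr R0 - 1"

text \<open>
  With unit noise power, interference \<open>I \<ge> 0\<close> leaves the rate \<open>R0\<close> decodable iff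
  \<open>\<rho>m * (cmod hm)\<^sup>2 / (1 + I) \<ge> snr_threshold R0\<close>; solving for \<open>I\<close> gives the bound below,
  truncated at 0 when no interference can be tolerated.
\<close>

definition max_interference :: "real \<Rightarrow> complex \<Rightarrow> real \<Rightarrow> real" where
  "max_interference \<rho>m hm R0 = max 0 (\<rho>m * (cmod hm)\<^sup>2 / snr_threshold R0 - 1)"

definition oma_rate :: "real \<Rightarrow> complex \<Rightarrow> real" where
  "oma_rate \<rho>n hn = log 2 (1 + \<rho>n * (cmod hn)\<^sup>2)"

definition hybrid_rate :: "real \<Rightarrow> complex \<Rightarrow> real \<Rightarrow> real \<Rightarrow> real" where
  "hybrid_rate \<rho>n hn \<beta>1 \<beta>2 =
     log 2 (1 + \<beta>1 * \<rho>n * (cmod hn)\<^sup>2) + log 2 (1 + \<beta>2 * \<rho>n * (cmod hn)\<^sup>2)"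

definition hybrid_feasible :: "real \<Rightarrow> complex \<Rightarrow> real \<Rightarrow> real \<Rightarrow> (real \<times> real) set" where
  "hybrid_feasible \<rho>n hn \<eta> \<tau> =
     {(\<beta>1, \<beta>2). \<beta>1 \<in> {0..1} \<and> \<beta>2 \<in> {0..1} \<and> \<beta>1 + \<beta>2 \<le> \<eta> \<and> \<beta>1 * \<rho>n * (cmod hn)\<^sup>2 \<le> \<tau>}"

definition hybrid_rates :: "real \<Rightarrow> complex \<Rightarrow> real \<Rightarrow> real \<Rightarrow> real set" where
  "hybrid_rates \<rho>n hn \<eta> \<tau> = {hybrid_rate \<rho>n hn \<beta>1 \<beta>2 | \<beta>1 \<beta>2. (\<beta>1, \<beta>2) \<in> hybrid_feasible \<rho>n hn \<eta> \<tau>}"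

text \<open>
  \<open>Max\<close> is only meaningful for finite sets, so the maximum of the set of achievable rates is
  expressed with \<open>Greatest\<close>. The lemmas below show that it is attained.
\<close>

definition max_hybrid_rate :: "real \<Rightarrow> complex \<Rightarrow> real \<Rightarrow> real \<Rightarrow> real" where
  "max_hybrid_rate \<rho>n hn \<eta> \<tau> = (GREATEST r. r \<in> hybrid_rates \<rho>n hn \<eta> \<tau>)"

lemma compact_hybrid_feasible: "compact (hybrid_feasible \<rho>n hn \<eta> \<tau>)"
proof -
  have "hybrid_feasible \<rho>n hn \<eta> \<tau> =
      ({0..1} \<times> {0..1}) \<inter> ({p. fst p + snd p \<le> \<eta>} \<inter> {p. fst p * \<rho>n * (cmod hn)\<^sup>2 \<le> \<tau>})"
    by (auto simp: hybrid_feasible_def)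
  moreover have "closed ({p::real \<times> real. fst p + snd p \<le> \<eta>} \<inter> {p. fst p * \<rho>n * (cmod hn)\<^sup>2 \<le> \<tau>})"
    by (intro closed_Int closed_Collect_le continuous_intros)
  ultimately show ?thesis
    by (simp add: compact_Int_closed compact_Times)
qed

lemma hybrid_rates_has_maximum:
  assumes "\<rho>n > 0" "\<eta> \<ge> 0" "\<tau> \<ge> 0"
  shows "\<exists>r\<in>hybrid_rates \<rho>n hn \<eta> \<tau>. \<forall>s\<in>hybrid_rates \<rho>n hn \<eta> \<tau>. s \<le> r"
proof -
  let ?F = "hybrid_feasible \<rho>n hn \<eta> \<tau>"
  have img: "hybrid_rates \<rho>n hn \<eta> \<tau> = (\<lambda>p. hybrid_rate \<rho>n hn (fst p) (snd p)) ` ?F"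
    unfolding hybrid_rates_def by force
  have pos: "1 + b * \<rho>n * (cmod hn)\<^sup>2 > 0" if "b \<ge> 0" for b
    using that assms(1) by (intro add_pos_nonneg) auto
  have "continuous_on ?F (\<lambda>p. hybrid_rate \<rho>n hn (fst p) (snd p))"
    unfolding hybrid_rate_def log_def
    by (intro continuous_intros) (auto simp: hybrid_feasible_def dest: pos)
  moreover have "(0, 0) \<in> ?F"
    using assms by (simp add: hybrid_feasible_def)
  ultimately show ?thesis
    unfolding img using continuous_attains_sup[OF compact_hybrid_feasible, of \<rho>n hn \<eta> \<tau>] by blast
qed

lemma max_hybrid_rate_is_maximum:
  assumes "\<rho>n > 0" "\<eta> \<ge> 0" "\<tau> \<ge> 0"
  shows "max_hybrid_rate \<rho>n hn \<eta> \<tau> \<in> hybrid_rates \<rho>n hn \<eta> \<tau>"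
    and "s \<in> hybrid_rates \<rho>n hn \<eta> \<tau> \<Longrightarrow> s \<le> max_hybrid_rate \<rho>n hn \<eta> \<tau>"
proof -
  obtain r where r: "r \<in> hybrid_rates \<rho>n hn \<eta> \<tau>" "\<And>s. s \<in> hybrid_rates \<rho>n hn \<eta> \<tau> \<Longrightarrow> s \<le> r"
    using hybrid_rates_has_maximum[OF assms] by blast
  have "max_hybrid_rate \<rho>n hn \<eta> \<tau> = r"
    unfolding max_hybrid_rate_def by (rule Greatest_equality) (use r in auto)
  with r show "max_hybrid_rate \<rho>n hn \<eta> \<tau> \<in> hybrid_rates \<rho>n hn \<eta> \<tau>"
    and "s \<in> hybrid_rates \<rho>n hn \<eta> \<tau> \<Longrightarrow> s \<le> max_hybrid_rate \<rho>n hn \<eta> \<tau>" by auto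
qed

end

theory Submission
  imports Defs
begin

text \<open>
  Write \<open>a = \<rho>n |hn|\<^sup>2\<close> and let \<open>t = \<beta>1 a\<close> be the received power in the slot of \<open>U_m\<close>. Spending all
  the energy, the sum rate is the logarithm of \<open>(1 + t) (1 + \<eta> a - t)\<close>, a concave parabola in \<open>t\<close>
  with apex \<open>\<eta> a / 2\<close>; under \<open>t \<le> \<tau>m\<close> it is maximal at \<open>t = min \<tau>m (\<eta> a / 2)\<close>. Comparing this
  maximum with \<open>1 + a\<close> gives one condition for each value of the minimum.
\<close>

text \<open>For \<open>u = min \<tau> (c / 2)\<close>, the values of
  \<open>(1 + x) * (1 + c - x)\<close> at \<open>u\<close> and at \<open>t\<close> differ by exactly
  \<open>(u - t) * (c - t - u)\<close>, so only the sign of this product matters.\<close>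

lemma prod_one_plus_le_capped_split:
  fixes s t c \<tau> :: real
  assumes "0 \<le> t" "t \<le> \<tau>" "t + s \<le> c"
  shows "(1 + t) * (1 + s) \<le> (1 + min \<tau> (c / 2)) * (1 + c - min \<tau> (c / 2))"
proof -
  define u where "u = min \<tau> (c / 2)"
  have "(u - t) * (c - t - u) \<ge> 0"
  proof (cases "t \<le> u")
    case True
    then have "c - t - u \<ge> 0"
      unfolding u_def by linarith
    with True show ?thesis by simp
  next
    case False
    \<comment> \<open>Since \<open>u < t \<le> \<tau>\<close>, the minimum is not
      \<open>\<tau>\<close>, so \<open>u = c / 2\<close> and the product is a square.\<close>
    then have "c - t - u = u - t"
      using assms unfolding u_def by linarith
    then show ?thesis by simp
  qed
  then have "(1 + t) * (1 + (c - t)) \<le> (1 + u) * (1 + c - u)"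
    by (simp add: algebra_simps)
  moreover have "(1 + t) * (1 + s) \<le> (1 + t) * (1 + (c - t))"
    using assms by (intro mult_left_mono) auto
  ultimately show ?thesis
    unfolding u_def by linarith
qed

lemma oma_rate_less_hybrid_rate_iff:
  assumes "\<rho>n \<ge> 0" "\<beta>1 \<ge> 0" "\<beta>2 \<ge> 0"
  shows "oma_rate \<rho>n hn < hybrid_rate \<rho>n hn \<beta>1 \<beta>2 \<longleftrightarrow>
    1 + \<rho>n * (cmod hn)\<^sup>2 < (1 + \<beta>1 * (\<rho>n * (cmod hn)\<^sup>2)) * (1 + \<beta>2 * (\<rho>n * (cmod hn)\<^sup>2))"
proof -
  define a where "a = \<rho>n * (cmod hn)\<^sup>2"
  have pos: "1 + b * a > 0" if "b \<ge> 0" for b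
    using that assms by (intro add_pos_nonneg) (auto simp: a_def)
  have "hybrid_rate \<rho>n hn \<beta>1 \<beta>2 = log 2 ((1 + \<beta>1 * a) * (1 + \<beta>2 * a))"
    using pos[OF assms(2)] pos[OF assms(3)]
    by (simp add: hybrid_rate_def log_mult a_def mult.assoc)
  moreover have "oma_rate \<rho>n hn = log 2 (1 + a)"
    by (simp add: oma_rate_def a_def)
  ultimately show ?thesis
    using pos[OF assms(2)] pos[OF assms(3)] pos[of 1] by (simp add: a_def)
qed

text \<open>Reduces the optimisation to one polynomial inequality. A maximising pair is bounded by
  the capped split with \<open>c = \<eta> * a\<close>; conversely, the bound is attained at received
  power \<open>u\<close>.\<close>

lemma oma_rate_less_max_hybrid_rate_iff:
  fixes \<rho>n \<eta> \<tau> :: real and hn :: complex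
  defines "a \<equiv> \<rho>n * (cmod hn)\<^sup>2"
  defines "u \<equiv> min \<tau> (\<eta> * a / 2)"
  assumes "\<rho>n > 0" "0 \<le> \<eta>" "\<eta> \<le> 1" "hn \<noteq> 0" "\<tau> \<ge> 0"
  shows "oma_rate \<rho>n hn < max_hybrid_rate \<rho>n hn \<eta> \<tau> \<longleftrightarrow> 1 + a < (1 + u) * (1 + \<eta> * a - u)"
proof
  assume less: "oma_rate \<rho>n hn < max_hybrid_rate \<rho>n hn \<eta> \<tau>"
  obtain \<beta>1 \<beta>2 where \<beta>: "(\<beta>1, \<beta>2) \<in> hybrid_feasible \<rho>n hn \<eta> \<tau>"
      "max_hybrid_rate \<rho>n hn \<eta> \<tau> = hybrid_rate \<rho>n hn \<beta>1 \<beta>2"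
    using max_hybrid_rate_is_maximum(1)[of \<rho>n \<eta> \<tau> hn] assms by (auto simp: hybrid_rates_def)
  have a: "a \<ge> 0"
    using assms by (simp add: a_def)
  have bounds: "\<beta>1 \<ge> 0" "\<beta>2 \<ge> 0" "\<beta>1 + \<beta>2 \<le> \<eta>" "\<beta>1 * a \<le> \<tau>"
    using \<beta>(1) by (auto simp: hybrid_feasible_def a_def mult.assoc)
  have "1 + a < (1 + \<beta>1 * a) * (1 + \<beta>2 * a)"
    using less \<beta>(2) bounds assms by (simp add: oma_rate_less_hybrid_rate_iff)
  also have "\<dots> \<le> (1 + u) * (1 + \<eta> * a - u)"
    unfolding u_def
  proof (rule prod_one_plus_le_capped_split)
    show "\<beta>1 * a + \<beta>2 * a \<le> \<eta> * a"
      using mult_right_mono[OF bounds(3) a] by (simp add: distrib_right)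
  qed (use bounds a in auto)
  finally show "1 + a < (1 + u) * (1 + \<eta> * a - u)" .
next
  assume gain: "1 + a < (1 + u) * (1 + \<eta> * a - u)"
  have a: "a > 0"
    using assms by (simp add: a_def)
  \<comment> \<open>This choice gives received power exactly \<open>u\<close> in the first slot. The
    partner \<open>\<eta> - \<beta>1\<close> spends the remaining energy and is nonnegative because
    \<open>u \<le> \<eta> * a / 2\<close>.\<close>
  define \<beta>1 where "\<beta>1 = u / a"
  have \<beta>1a: "\<beta>1 * a = u"
    using a by (simp add: \<beta>1_def)
  have "0 \<le> u" "u \<le> \<eta> * a / 2" "u \<le> \<tau>"
    using assms a by (auto simp: u_def)
  then have \<beta>1: "0 \<le> \<beta>1" "\<beta>1 \<le> \<eta> / 2" "\<beta>1 * a \<le> \<tau>"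
    using a \<beta>1a by (auto simp: \<beta>1_def field_simps)
  then have "(\<beta>1, \<eta> - \<beta>1) \<in> hybrid_feasible \<rho>n hn \<eta> \<tau>"
    using assms(3-5) by (auto simp: hybrid_feasible_def a_def mult.assoc)
  then have "hybrid_rate \<rho>n hn \<beta>1 (\<eta> - \<beta>1) \<in> hybrid_rates \<rho>n hn \<eta> \<tau>"
    by (auto simp: hybrid_rates_def)
  then have "hybrid_rate \<rho>n hn \<beta>1 (\<eta> - \<beta>1) \<le> max_hybrid_rate \<rho>n hn \<eta> \<tau>"
    using assms by (intro max_hybrid_rate_is_maximum(2)) auto
  moreover have "1 + a < (1 + \<beta>1 * a) * (1 + (\<eta> - \<beta>1) * a)"
    using gain \<beta>1a by (simp add: left_diff_distrib add_diff_eq)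
  then have "oma_rate \<rho>n hn < hybrid_rate \<rho>n hn \<beta>1 (\<eta> - \<beta>1)"
    using \<beta>1 assms by (simp add: oma_rate_less_hybrid_rate_iff)
  ultimately show "oma_rate \<rho>n hn < max_hybrid_rate \<rho>n hn \<eta> \<tau>"
    by simp
qed

theorem corollary1:
  fixes \<rho>n \<rho>m R0 \<eta> \<tau>m :: real and hn hm :: complex
  assumes "\<rho>n > 0" and "\<rho>m > 0" and "R0 > 0" and "0 < \<eta>" and "\<eta> \<le> 1" and "hn \<noteq> 0"
    and "\<tau>m = max_interference \<rho>m hm R0"
  shows "max_hybrid_rate \<rho>n hn \<eta> \<tau>m > oma_rate \<rho>n hn \<longleftrightarrow>
      (\<tau>m / (\<rho>n * (cmod hn)\<^sup>2) \<ge> \<eta> / 2 \<and> (cmod hn)\<^sup>2 > 4 * (1 - \<eta>) / (\<eta>\<^sup>2 * \<rho>n)) \<or>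
      (0 < \<tau>m / (\<rho>n * (cmod hn)\<^sup>2) \<and> \<tau>m / (\<rho>n * (cmod hn)\<^sup>2) < \<eta> / 2 \<and>
       \<tau>m > 1 / \<eta> - 1 \<and>
       (cmod hn)\<^sup>2 > \<tau>m\<^sup>2 / (\<rho>n * (\<eta> + \<tau>m * \<eta> - 1)))"
proof -
  define a where "a = \<rho>n * (cmod hn)\<^sup>2"
  have a: "a > 0"
    using assms by (simp add: a_def)
  have \<tau>: "\<tau>m \<ge> 0"
    using assms(7) by (simp add: max_interference_def)
  define u where "u = min \<tau>m (\<eta> * a / 2)"
  have lhs: "oma_rate \<rho>n hn < max_hybrid_rate \<rho>n hn \<eta> \<tau>m \<longleftrightarrow> 1 + a < (1 + u) * (1 + \<eta> * a - u)"
    unfolding u_def a_def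
    using assms \<tau> by (intro oma_rate_less_max_hybrid_rate_iff) auto
  have half: "\<tau>m / a \<ge> \<eta> / 2 \<longleftrightarrow> \<tau>m \<ge> \<eta> * a / 2"
    using a by (simp add: field_simps)
  have first: "(cmod hn)\<^sup>2 > 4 * (1 - \<eta>) / (\<eta>\<^sup>2 * \<rho>n) \<longleftrightarrow> 4 * (1 - \<eta>) < \<eta>\<^sup>2 * a"
    using assms(1,4) by (simp add: a_def pos_divide_less_eq mult_ac)
  \<comment> \<open>The bound \<open>\<tau>m > 1 / \<eta> - 1\<close> says that the denominator is
    positive, which permits clearing it. In the converse direction, positivity follows from
    \<open>\<tau>m\<^sup>2 \<ge> 0\<close>.\<close>
  have second: "\<tau>m > 1 / \<eta> - 1 \<and> (cmod hn)\<^sup>2 > \<tau>m\<^sup>2 / (\<rho>n * (\<eta> + \<tau>m * \<eta> - 1)) \<longleftrightarrow>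
      \<tau>m\<^sup>2 < a * (\<eta> + \<tau>m * \<eta> - 1)"
  proof -
    have "\<tau>m > 1 / \<eta> - 1 \<longleftrightarrow> \<eta> + \<tau>m * \<eta> - 1 > 0"
      using assms(4) by (auto simp: field_simps)
    moreover have "\<eta> + \<tau>m * \<eta> - 1 > 0" if "\<tau>m\<^sup>2 < a * (\<eta> + \<tau>m * \<eta> - 1)"
    proof -
      have "0 < a * (\<eta> + \<tau>m * \<eta> - 1)"
        using that zero_le_power2[of \<tau>m] by linarith
      then show ?thesis
        using a by (simp add: zero_less_mult_iff)
    qed
    ultimately show ?thesis
      using assms(1) by (auto simp: a_def pos_divide_less_eq mult_ac)
  qed
  show ?thesis
  proof (cases "\<tau>m \<ge> \<eta> * a / 2")
    case True
    then have "u = \<eta> * a / 2"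
      by (simp add: u_def)
    \<comment> \<open>At the apex both factors equal \<open>1 + \<eta> * a / 2\<close>; the constant
      terms cancel and the positive factor \<open>a / 4\<close> splits off.\<close>
    then have "(1 + u) * (1 + \<eta> * a - u) - (1 + a) = a / 4 * (\<eta>\<^sup>2 * a - 4 * (1 - \<eta>))"
      by (simp only:) (simp add: field_simps power2_eq_square)
    then have "1 + a < (1 + u) * (1 + \<eta> * a - u) \<longleftrightarrow> 0 < a / 4 * (\<eta>\<^sup>2 * a - 4 * (1 - \<eta>))"
      by linarith
    also have "\<dots> \<longleftrightarrow> 4 * (1 - \<eta>) < \<eta>\<^sup>2 * a"
      using a by (simp add: zero_less_mult_iff)
    finally show ?thesis
      using lhs True half first unfolding a_def by auto
  next
    case False
    then have "u = \<tau>m"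
      by (simp add: u_def)
    then have "(1 + u) * (1 + \<eta> * a - u) - (1 + a) = a * (\<eta> + \<tau>m * \<eta> - 1) - \<tau>m\<^sup>2"
      by (simp add: algebra_simps power2_eq_square)
    then have gain: "1 + a < (1 + u) * (1 + \<eta> * a - u) \<longleftrightarrow> \<tau>m\<^sup>2 < a * (\<eta> + \<tau>m * \<eta> - 1)"
      by linarith
    \<comment> \<open>The second alternative also asks for \<open>\<tau>m > 0\<close>. The gain
      supplies it: at \<open>\<tau>m = 0\<close> it would read \<open>0 < a * (\<eta> - 1)\<close>,
      against \<open>\<eta> \<le> 1\<close>.\<close>
    have "\<tau>m > 0" if "\<tau>m\<^sup>2 < a * (\<eta> + \<tau>m * \<eta> - 1)"
    proof (rule ccontr)
      assume "\<not> \<tau>m > 0"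
      with \<tau> that have "0 < a * (\<eta> - 1)"
        by simp
      with a assms(5) show False
        by (simp add: zero_less_mult_iff)
    qed
    then show ?thesis
      using lhs gain half second False a unfolding a_def by (auto simp: zero_less_divide_iff)
  qed
qed

end
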